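(* Let $H\le F$ be a non-trivial subgroup with Schreier graph $X=H\backslash F$ and limit set $\Lambda\subset\partial F$. Then $\Lambda=\partial F$ if and only if $X$ has no hanging branches (i.e., $X_*=X$, where $X_*$ is the core of $X$).
   Context: $F$ is the free group freely generated by a finite set $\mathcal A$ with $|\mathcal A|=m\ge 2$; $\breve{\mathcal A}=\mathcal A\sqcup\mathcal A^{-1}$. Elements of $F$ are identified with finite freely reduced words in $\breve{\mathcal A}$. $\partial F$ is the set of infinite freely reduced words with the product topology, and $\widehat F=F\cup\partial F$ is the compactification in which $g_n\in F$ converges to $\omega\in\partial F$ iff the reduced words of $g_n$ converge pointwise to $\omega$. The limit set $\Lambda$ of $H$ is the set of points of $\partial F$ that are limit points of $H$ in $\widehat F$. The Schreier graph $X=H\backslash F$ has the cosets $Hg$ as vertices and, for each vertex $x$ and $a\in\breve{\mathcal A}$, an oriented edge from $x$ to $xa$ labelled $a$, whose reversal is the edge from $xa$ to $x$ labelled $a^{-1}$ (loops and multiple edges allowed). A branch of the $2m$-regular tree is a subtree with one vertex (the root) of degree $1$ and all other vertices (its interior) of full degree $2m$. A hanging branch of $X$ is a subgraph of $X$ isomorphic (with its labelling) to a branch of the Cayley tree of $F$. The core $X_*$ is obtained by removing from $X$ all the edges and all the interior vertices of all hanging branches. *)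

theory Defs
  imports
    "HOL-Analysis.Abstract_Limits"
    "HOL-Analysis.Function_Topology"
    "HOL-Algebra.Coset"
    "Graph_Theory.Digraph_Component"
begin

section \<open>The free group\<close>

text \<open>The letter \<open>(a, True)\<close> stands for \<open>a\<close> and \<open>(a, False)\<close> for the inverse of \<open>a\<close>.\<close>

type_synonym 'a letter = "'a \<times> bool"

definition letters :: "'a set \<Rightarrow> 'a letter set" where
  "letters A = A \<times> UNIV"

definition linv :: "'a letter \<Rightarrow> 'a letter" where
  "linv x = (fst x, \<not> snd x)"

definition reduced :: "'a letter list \<Rightarrow> bool" where
  "reduced w \<longleftrightarrow> (\<forall>i. Suc i < length w \<longrightarrow> w ! Suc i \<noteq> linv (w ! i))"

text \<open>Left multiplication of a reduced word by a single letter, with cancellation.\<close>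

fun lcons :: "'a letter \<Rightarrow> 'a letter list \<Rightarrow> 'a letter list" where
  "lcons x [] = [x]"
| "lcons x (y # w) = (if y = linv x then w else x # y # w)"

definition freduce :: "'a letter list \<Rightarrow> 'a letter list" where
  "freduce w = foldr lcons w []"

definition free_group :: "'a set \<Rightarrow> 'a letter list monoid" where
  "free_group A =
     \<lparr>carrier = {w. set w \<subseteq> letters A \<and> reduced w},
      monoid.mult = (\<lambda>u v. freduce (u @ v)),
      one = []\<rparr>"

lemma linv_linv [simp]: "linv (linv x) = x"
  by (simp add: linv_def)

lemma reduced_Nil [simp]: "reduced []"
  by (simp add: reduced_def)

lemma reduced_Cons:
  "reduced (x # w) \<longleftrightarrow> reduced w \<and> (w \<noteq> [] \<longrightarrow> hd w \<noteq> linv x)"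
proof (cases w)
  case Nil
  then show ?thesis by (simp add: reduced_def)
next
  case (Cons y v)
  then show ?thesis
    unfolding reduced_def by (auto simp: nth_Cons split: nat.splits)
qed

lemma reduced_lcons: "reduced w \<Longrightarrow> reduced (lcons x w)"
  by (cases w) (auto simp: reduced_Cons)

lemma lcons_linv: "reduced w \<Longrightarrow> lcons x (lcons (linv x) w) = w"
proof (cases w)
  case (Cons y v)
  assume "reduced w"
  with Cons show ?thesis by (cases v) (auto simp: reduced_Cons)
qed simp

lemma foldr_lcons_reduced: "reduced w \<Longrightarrow> reduced (foldr lcons u w)"
  by (induction u) (auto simp: reduced_lcons)

lemma reduced_freduce: "reduced (freduce w)"
  by (simp add: freduce_def foldr_lcons_reduced)

lemma set_foldr_lcons: "set (foldr lcons u w) \<subseteq> set u \<union> set w"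
proof (induction u)
  case (Cons x u)
  have "set (lcons x v) \<subseteq> insert x (set v)" for v
    by (cases v) auto
  with Cons show ?case by fastforce
qed simp

lemma set_freduce: "set (freduce w) \<subseteq> set w"
  using set_foldr_lcons[of w "[]"] by (simp add: freduce_def)

lemma freduce_reduced: "reduced w \<Longrightarrow> freduce w = w"
proof (induction w)
  case (Cons x w)
  then show ?case
    by (cases w) (auto simp: freduce_def reduced_Cons)
qed (simp add: freduce_def)

lemma foldr_lcons_lcons:
  "reduced w \<Longrightarrow> foldr lcons (lcons x v) w = lcons x (foldr lcons v w)"
  by (cases v) (auto simp: lcons_linv foldr_lcons_reduced)

lemma foldr_lcons_freduce:
  "reduced w \<Longrightarrow> foldr lcons (freduce u) w = foldr lcons u w"
  by (induction u) (auto simp: freduce_def foldr_lcons_lcons)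

lemma freduce_append_left: "freduce (freduce u @ v) = freduce (u @ v)"
  using foldr_lcons_freduce[OF reduced_freduce, of u v] by (simp add: freduce_def)

lemma freduce_append_right: "freduce (u @ freduce v) = freduce (u @ v)"
  using freduce_reduced[OF reduced_freduce, of v] by (simp add: freduce_def)

lemma freduce_inverse: "freduce (rev (map linv w) @ w) = []"
proof (induction w)
  case (Cons x w)
  have "lcons (linv x) (lcons x (freduce w)) = freduce w"
    using lcons_linv[OF reduced_freduce, of "linv x"] by simp
  with Cons show ?case
    by (simp add: freduce_def)
qed (simp add: freduce_def)

lemma reduced_append_single:
  "reduced (w @ [x]) \<longleftrightarrow> reduced w \<and> (w \<noteq> [] \<longrightarrow> x \<noteq> linv (last w))"
  by (induction w) (auto simp: reduced_Cons)

lemma reduced_inverse: "reduced w \<Longrightarrow> reduced (rev (map linv w))"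
  by (induction w)
     (auto simp: reduced_Cons reduced_append_single last_rev hd_map)

lemma group_free_group: "group (free_group A)"
proof (rule groupI)
  fix u v w
  show "u \<otimes>\<^bsub>free_group A\<^esub> v \<otimes>\<^bsub>free_group A\<^esub> w = u \<otimes>\<^bsub>free_group A\<^esub> (v \<otimes>\<^bsub>free_group A\<^esub> w)"
    by (simp add: free_group_def freduce_append_left freduce_append_right)
next
  fix u assume u: "u \<in> carrier (free_group A)"
  show "\<exists>v \<in> carrier (free_group A). v \<otimes>\<^bsub>free_group A\<^esub> u = \<one>\<^bsub>free_group A\<^esub>"
  proof
    show "rev (map linv u) \<in> carrier (free_group A)"
      using u by (auto simp: free_group_def reduced_inverse letters_def linv_def)
    show "rev (map linv u) \<otimes>\<^bsub>free_group A\<^esub> u = \<one>\<^bsub>free_group A\<^esub>"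
      by (simp add: free_group_def freduce_inverse)
  qed
qed (use set_freduce in
     \<open>force simp: free_group_def reduced_freduce freduce_reduced\<close>)+


section \<open>Boundary, compactification and limit set\<close>

definition boundary :: "'a set \<Rightarrow> (nat \<Rightarrow> 'a letter) set" where
  "boundary A = {\<omega>. \<forall>i. \<omega> i \<in> letters A \<and> \<omega> (Suc i) \<noteq> linv (\<omega> i)}"

text \<open>
  Finite and infinite words are both embedded in the space of all sequences over the alphabet
  extended by the blank symbol \<open>None\<close>; a finite word is padded with blanks.  The topology of
  pointwise convergence then makes every finite word an isolated point.
\<close>

definition word_pt :: "'a letter list \<Rightarrow> nat \<Rightarrow> 'a letter option" where
  "word_pt w = (\<lambda>i. if i < length w then Some (w ! i) else None)"

definition bdry_pt :: "(nat \<Rightarrow> 'a letter) \<Rightarrow> nat \<Rightarrow> 'a letter option" where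
  "bdry_pt \<omega> = (\<lambda>i. Some (\<omega> i))"

definition compactification :: "'a set \<Rightarrow> (nat \<Rightarrow> 'a letter option) topology" where
  "compactification A =
     subtopology (product_topology (\<lambda>_. discrete_topology UNIV) UNIV)
       (word_pt ` carrier (free_group A) \<union> bdry_pt ` boundary A)"

lemma limitin_compactification_iff:
  assumes "\<And>n. g n \<in> carrier (free_group A)" and "\<omega> \<in> boundary A"
  shows "limitin (compactification A) (\<lambda>n. word_pt (g n)) (bdry_pt \<omega>) sequentially
    \<longleftrightarrow> (\<forall>i. \<forall>\<^sub>F n in sequentially. i < length (g n) \<and> g n ! i = \<omega> i)"
proof -
  have discrete: "limitin (discrete_topology UNIV) f l F \<longleftrightarrow> (\<forall>\<^sub>F n in F. f n = l)"
    for f :: "nat \<Rightarrow> 'a letter option" and l F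
    unfolding limitin_def
    by (auto elim: eventually_mono dest: spec[of _ "{l}"])
  have "word_pt (g n) i = bdry_pt \<omega> i \<longleftrightarrow> i < length (g n) \<and> g n ! i = \<omega> i" for n i
    by (simp add: word_pt_def bdry_pt_def)
  then show ?thesis
    using assms
    by (simp add: compactification_def limitin_subtopology limitin_componentwise discrete)
qed

definition limit_set :: "'a set \<Rightarrow> 'a letter list set \<Rightarrow> (nat \<Rightarrow> 'a letter) set" where
  "limit_set A H =
     {\<omega> \<in> boundary A. bdry_pt \<omega> \<in> compactification A derived_set_of (word_pt ` H)}"


section \<open>Labelled graphs\<close>

text \<open>
  An oriented edge is a pair consisting of its initial vertex and its label.  All graphs contain
  with every oriented edge its reversal, so that the degree of a vertex in the unoriented sense
  (a loop counted twice) is the library's \<^const>\<open>out_degree\<close>.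
\<close>

type_synonym ('v, 'a) lgraph = "('v, 'v \<times> 'a letter) pre_digraph"

definition edge_rev :: "('v, 'a) lgraph \<Rightarrow> 'v \<times> 'a letter \<Rightarrow> 'v \<times> 'a letter" where
  "edge_rev X e = (head X e, linv (snd e))"

definition schreier_graph :: "'a set \<Rightarrow> 'a letter list set \<Rightarrow> ('a letter list set, 'a) lgraph" where
  "schreier_graph A H =
     \<lparr>verts = rcosets\<^bsub>free_group A\<^esub> H,
      arcs = (rcosets\<^bsub>free_group A\<^esub> H) \<times> letters A,
      tail = fst,
      head = (\<lambda>(x, a). x #>\<^bsub>free_group A\<^esub> [a])\<rparr>"

definition cayley_tree :: "'a set \<Rightarrow> ('a letter list, 'a) lgraph" where
  "cayley_tree A =
     \<lparr>verts = carrier (free_group A),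
      arcs = carrier (free_group A) \<times> letters A,
      tail = fst,
      head = (\<lambda>(g, a). g \<otimes>\<^bsub>free_group A\<^esub> [a])\<rparr>"

definition lsubgraph :: "('v, 'a) lgraph \<Rightarrow> ('v, 'a) lgraph \<Rightarrow> bool" where
  "lsubgraph B X \<longleftrightarrow> subgraph B X \<and> (\<forall>e \<in> arcs B. edge_rev X e \<in> arcs B)"

text \<open>Compatibility with reversal of edges follows, as labels are preserved.\<close>

definition lgraph_iso :: "('v, 'a) lgraph \<Rightarrow> ('w, 'a) lgraph \<Rightarrow> bool" where
  "lgraph_iso B C \<longleftrightarrow>
     (\<exists>f g. bij_betw f (verts B) (verts C) \<and> bij_betw g (arcs B) (arcs C) \<and>
        (\<forall>e \<in> arcs B. tail C (g e) = f (tail B e) \<and> head C (g e) = f (head B e) \<and>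
           snd (g e) = snd e))"


section \<open>Hanging branches and the core\<close>

text \<open>
  A subtree of a tree is a connected subgraph.  (The library's \<^const>\<open>tree\<close> does not apply:
  it regards an edge followed by its reversal as a cycle.)
\<close>

definition branch :: "'a set \<Rightarrow> ('a letter list, 'a) lgraph \<Rightarrow> bool" where
  "branch A T \<longleftrightarrow>
     lsubgraph T (cayley_tree A) \<and> Digraph_Component.connected T \<and>
     (\<exists>r \<in> verts T. out_degree T r = 1 \<and>
        (\<forall>v \<in> verts T - {r}. out_degree T v = 2 * card A))"

definition hanging_branch :: "'a set \<Rightarrow> ('v, 'a) lgraph \<Rightarrow> ('v, 'a) lgraph \<Rightarrow> bool" where
  "hanging_branch A X B \<longleftrightarrow> lsubgraph B X \<and> (\<exists>T. branch A T \<and> lgraph_iso T B)"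

definition branch_interior :: "'a set \<Rightarrow> ('v, 'a) lgraph \<Rightarrow> 'v set" where
  "branch_interior A B = {v \<in> verts B. out_degree B v = 2 * card A}"

definition core :: "'a set \<Rightarrow> ('v, 'a) lgraph \<Rightarrow> ('v, 'a) lgraph" where
  "core A X =
     X\<lparr>verts := verts X - (\<Union>B \<in> {B. hanging_branch A X B}. branch_interior A B),
       arcs := arcs X - (\<Union>B \<in> {B. hanging_branch A X B}. arcs B)\<rparr>"

end

theory Submission
  imports Defs
begin

text \<open>
  Call a nonempty reduced word \<open>p\<close> avoided if it is not a prefix of an element of \<open>H\<close>.  A boundary
  point lies outside the limit set iff one of its prefixes is avoided, so the limit set is proper
  iff an avoided word exists.

  If \<open>p\<close> is avoided, the words with prefix \<open>p\<close> represent pairwise distinct cosets; hence the branch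
  of the Cayley tree with root \<open>p\<close> whose edge at the root prolongs \<open>p\<close> embeds into the Schreier
  graph.  Conversely, in a hanging branch with root \<open>Hg\<close> and first edge \<open>c\<close> the cosets \<open>Hgcu\<close>
  (\<open>cu\<close> reduced) are distinct, so \<open>H\<close> itself occurs at most once among them, and the reduced form
  of \<open>gc\<^sup>k\<close> is avoided for large \<open>k\<close>.
\<close>

section \<open>Reduced words\<close>

lemma reduced_append:
  "reduced (u @ v) \<longleftrightarrow>
     reduced u \<and> reduced v \<and> (u \<noteq> [] \<and> v \<noteq> [] \<longrightarrow> hd v \<noteq> linv (last u))"
  by (induction u) (auto simp: reduced_Cons hd_append)

text \<open>Reducedness concerns adjacent letters only, and with \<open>v\<close> nonempty every
  adjacent pair of \<open>u @ v @ w\<close> lies in \<open>u @ v\<close> or in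
  \<open>v @ w\<close>.\<close>

lemma reduced_overlap:
  "reduced (u @ v) \<Longrightarrow> reduced (v @ w) \<Longrightarrow> v \<noteq> [] \<Longrightarrow> reduced (u @ v @ w)"
  by (auto simp: reduced_append)

lemma linv_neq [simp]: "linv x \<noteq> x" "x \<noteq> linv x"
  by (auto simp: linv_def prod_eq_iff)

lemma linv_eq_iff [simp]: "linv x = linv y \<longleftrightarrow> x = y"
  by (metis linv_linv)

lemma linv_in_letters [simp]: "linv x \<in> letters A \<longleftrightarrow> x \<in> letters A"
  by (auto simp: linv_def letters_def mem_Times_iff)

lemma reduced_replicate: "reduced (replicate k c)"
  by (auto simp: reduced_def)

text \<open>Each letter of \<open>g\<close> either cancels one letter or is put in front, so at most
  \<open>length g\<close> letters of \<open>w\<close> disappear. This bounds cancellation in all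
  later length estimates.\<close>

lemma foldr_lcons_suffix:
  "\<exists>v i. i \<le> length g \<and> foldr lcons g w = v @ drop i w"
proof (induction g)
  case Nil
  show ?case by (rule exI[of _ "[]"], rule exI[of _ 0]) simp
next
  case (Cons x g)
  then obtain v i where vi: "i \<le> length g" "foldr lcons g w = v @ drop i w"
    by blast
  show ?case
  proof (cases v)
    case Nil
    show ?thesis
    proof (cases "i < length w \<and> w ! i = linv x")
      case True
      then have "foldr lcons (x # g) w = [] @ drop (Suc i) w"
        using vi Nil by (simp flip: Cons_nth_drop_Suc)
      then show ?thesis
        using vi by (metis Suc_le_mono length_Cons)
    next
      case False
      then have "foldr lcons (x # g) w = [x] @ drop i w"
        using vi Nil by (cases "i < length w") (simp_all flip: Cons_nth_drop_Suc)
      then show ?thesis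
        using vi by (metis le_SucI length_Cons)
    qed
  next
    case (Cons y v')
    then have "foldr lcons (x # g) w = (if y = linv x then v' else x # v) @ drop i w"
      using vi by simp
    then show ?thesis
      using vi by (metis le_SucI length_Cons)
  qed
qed

lemma freduce_append_suffix:
  assumes "reduced w"
  obtains v i where "i \<le> length g" "freduce (g @ w) = v @ drop i w"
proof -
  have "freduce (g @ w) = foldr lcons g w"
    using freduce_reduced[OF assms] by (simp add: freduce_def)
  then show ?thesis
    using foldr_lcons_suffix[of g w] that by metis
qed

text \<open>\<open>freduce\<close> is built from multiplication on the left, whereas the edges of
  both graphs multiply on the right; this is the counterpart of \<open>lcons\<close> at the other
  end.\<close>

lemma freduce_snoc:
  assumes "reduced w"
  shows "freduce (w @ [a]) =
    (if w \<noteq> [] \<and> a = linv (last w) then butlast w else w @ [a])"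
proof (cases "w \<noteq> [] \<and> a = linv (last w)")
  case True
  then obtain v b where w: "w = v @ [b]" "a = linv b"
    by (metis append_butlast_last_id)
  then have "freduce v = v"
    using assms by (simp add: reduced_append_single freduce_reduced)
  then show ?thesis
    using w by (simp add: freduce_def)
next
  case False
  then have "reduced (w @ [a])"
    using assms by (auto simp: reduced_append_single)
  then show ?thesis
    using False by (auto simp: freduce_reduced)
qed

section \<open>Group operations on reduced words\<close>

lemma carrier_free_group: "w \<in> carrier (free_group A) \<longleftrightarrow> set w \<subseteq> letters A \<and> reduced w"
  by (simp add: free_group_def)

lemma mult_free_group: "u \<otimes>\<^bsub>free_group A\<^esub> v = freduce (u @ v)"
  by (simp add: free_group_def)

lemma one_free_group: "\<one>\<^bsub>free_group A\<^esub> = []"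
  by (simp add: free_group_def)

lemma freduce_in_carrier: "set w \<subseteq> letters A \<Longrightarrow> freduce w \<in> carrier (free_group A)"
  using set_freduce[of w] by (auto simp: carrier_free_group reduced_freduce)

lemma inv_free_group:
  assumes "w \<in> carrier (free_group A)"
  shows "inv\<^bsub>free_group A\<^esub> w = rev (map linv w)"
proof (rule group.inv_equality[OF group_free_group])
  show "rev (map linv w) \<otimes>\<^bsub>free_group A\<^esub> w = \<one>\<^bsub>free_group A\<^esub>"
    by (simp add: mult_free_group one_free_group freduce_inverse)
  show "rev (map linv w) \<in> carrier (free_group A)"
    using assms by (auto simp: carrier_free_group reduced_inverse)
qed (fact assms)

section \<open>The limit set\<close>

lemma openin_cylinder:
  "openin (product_topology (\<lambda>_. discrete_topology UNIV) UNIV) {x. \<forall>i<n. x i = y i}"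
  for n :: nat
proof -
  have "{x. \<forall>i<n. x i = y i} = (\<Pi>\<^sub>E i\<in>UNIV. if i < n then {y i} else UNIV)"
    by (force simp: PiE_UNIV_domain Pi_iff split: if_splits)
  moreover have "finite {i. (if i < n then {y i} else UNIV) \<noteq> topspace (discrete_topology UNIV)}"
    by (rule finite_subset[of _ "{..<n}"]) auto
  ultimately show ?thesis
    using product_topology_basis[of "\<lambda>_. discrete_topology UNIV" "\<lambda>i. if i < n then {y i} else UNIV" UNIV]
    by simp
qed

text \<open>Membership in a cylinder around \<open>bdry_pt \<omega>\<close> means sharing a prefix
  with \<open>\<omega>\<close>; conversely, elements of \<open>H\<close> sharing longer and longer
  prefixes converge to \<open>\<omega>\<close>.\<close>

lemma limit_set_iff:
  assumes "H \<subseteq> carrier (free_group A)"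
  shows "\<omega> \<in> limit_set A H \<longleftrightarrow> \<omega> \<in> boundary A \<and> (\<forall>n. \<exists>u. map \<omega> [0..<n] @ u \<in> H)"
proof (cases "\<omega> \<in> boundary A")
  case True
  have top: "bdry_pt \<omega> \<in> topspace (compactification A)"
    using True by (auto simp: compactification_def)
  show ?thesis
  proof (intro iffI conjI True allI)
    fix n
    assume "\<omega> \<in> limit_set A H"
    moreover define U where "U = {x. \<forall>i<n. x i = bdry_pt \<omega> i} \<inter>
      (word_pt ` carrier (free_group A) \<union> bdry_pt ` boundary A)"
    have "openin (compactification A) U"
      unfolding U_def compactification_def openin_subtopology
      using openin_cylinder by blast
    moreover have "bdry_pt \<omega> \<in> U"
      using True by (auto simp: U_def)
    ultimately obtain h where h: "h \<in> H" "word_pt h \<in> U"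
      unfolding limit_set_def in_derived_set_of by blast
    then have "\<forall>i<n. i < length h \<and> h ! i = \<omega> i"
      by (auto simp: U_def word_pt_def bdry_pt_def split: if_splits)
    \<comment> \<open>Otherwise the preceding fact at \<open>i = length h\<close> would give
      \<open>length h < length h\<close>.\<close>
    moreover from this have "n \<le> length h"
      by (metis less_irrefl not_le_imp_less)
    ultimately have "take n h = map \<omega> [0..<n]"
      by (intro nth_equalityI) auto
    then show "\<exists>u. map \<omega> [0..<n] @ u \<in> H"
      using h(1) by (metis append_take_drop_id)
  next
    assume "\<omega> \<in> boundary A \<and> (\<forall>n. \<exists>u. map \<omega> [0..<n] @ u \<in> H)"
    then obtain u where u: "\<And>n. map \<omega> [0..<n] @ u n \<in> H"
      by metis
    have "limitin (compactification A) (\<lambda>n. word_pt (map \<omega> [0..<n] @ u n)) (bdry_pt \<omega>) sequentially"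
    proof (subst limitin_compactification_iff)
      show "\<forall>i. \<forall>\<^sub>F n in sequentially. i < length (map \<omega> [0..<n] @ u n) \<and>
          (map \<omega> [0..<n] @ u n) ! i = \<omega> i"
      proof
        fix i
        show "\<forall>\<^sub>F n in sequentially. i < length (map \<omega> [0..<n] @ u n) \<and>
          (map \<omega> [0..<n] @ u n) ! i = \<omega> i"
          using eventually_gt_at_top[of i] by eventually_elim (simp add: nth_append)
      qed
    qed (use u True assms in auto)
    then have ev: "\<forall>\<^sub>F n in sequentially. word_pt (map \<omega> [0..<n] @ u n) \<in> U"
      if "openin (compactification A) U" "bdry_pt \<omega> \<in> U" for U
      using that by (simp add: limitin_def)
    \<comment> \<open>A finite word is padded with blanks and a boundary point has none, so the
      points of \<open>H\<close> near \<open>\<omega>\<close> are automatically different from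
      it.\<close>
    have neq: "word_pt h \<noteq> bdry_pt \<omega>" for h
      by (auto simp: word_pt_def bdry_pt_def fun_eq_iff)
    have "\<exists>y. y \<noteq> bdry_pt \<omega> \<and> y \<in> word_pt ` H \<and> y \<in> U"
      if U: "bdry_pt \<omega> \<in> U \<and> openin (compactification A) U" for U
    proof -
      obtain n where "word_pt (map \<omega> [0..<n] @ u n) \<in> U"
        using eventually_happens[OF ev[of U]] U by auto
      then show ?thesis
        using u neq by blast
    qed
    then show "\<omega> \<in> limit_set A H"
      unfolding limit_set_def in_derived_set_of using True top by blast
  qed
next
  case False
  then show ?thesis by (simp add: limit_set_def)
qed

section \<open>Graphs\<close>

lemma letters_card: "card (letters A) = 2 * card A"
  by (simp add: letters_def card_cartesian_product)

lemma finite_letters: "finite A \<Longrightarrow> finite (letters A)"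
  by (simp add: letters_def)

lemma cayley_tree_simps [simp]:
  "verts (cayley_tree A) = carrier (free_group A)"
  "arcs (cayley_tree A) = carrier (free_group A) \<times> letters A"
  "tail (cayley_tree A) = fst"
  "head (cayley_tree A) (g, a) = freduce (g @ [a])"
  by (auto simp: cayley_tree_def mult_free_group)

lemma schreier_graph_simps [simp]:
  "verts (schreier_graph A H) = rcosets\<^bsub>free_group A\<^esub> H"
  "arcs (schreier_graph A H) = (rcosets\<^bsub>free_group A\<^esub> H) \<times> letters A"
  "tail (schreier_graph A H) = fst"
  "head (schreier_graph A H) (x, a) = x #>\<^bsub>free_group A\<^esub> [a]"
  by (auto simp: schreier_graph_def)

lemma rcoset_step:
  assumes "H \<subseteq> carrier (free_group A)" "set u \<subseteq> letters A" "set v \<subseteq> letters A"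
  shows "(H #>\<^bsub>free_group A\<^esub> freduce u) #>\<^bsub>free_group A\<^esub> freduce v =
    H #>\<^bsub>free_group A\<^esub> freduce (u @ v)"
  using group.coset_mult_assoc[OF group_free_group assms(1) freduce_in_carrier[OF assms(2)]
      freduce_in_carrier[OF assms(3)]]
  by (simp add: mult_free_group freduce_append_left freduce_append_right)

lemma rcoset_word_step:
  assumes "H \<subseteq> carrier (free_group A)" "u \<in> carrier (free_group A)" "a \<in> letters A"
  shows "(H #>\<^bsub>free_group A\<^esub> u) #>\<^bsub>free_group A\<^esub> [a] = H #>\<^bsub>free_group A\<^esub> freduce (u @ [a])"
  using rcoset_step[OF assms(1), of u "[a]"] assms
  by (simp add: carrier_free_group freduce_reduced reduced_Cons)

lemma freduce_snoc_in_carrier: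
  assumes "g \<in> carrier (free_group A)" "a \<in> letters A"
  shows "freduce (g @ [a]) \<in> carrier (free_group A)"
  using assms by (intro freduce_in_carrier) (auto simp: carrier_free_group)

lemma wf_cayley_tree: "wf_digraph (cayley_tree A)"
  by unfold_locales (auto simp: freduce_snoc_in_carrier)

lemma wf_schreier_graph:
  assumes "H \<subseteq> carrier (free_group A)"
  shows "wf_digraph (schreier_graph A H)"
proof
  fix e assume "e \<in> arcs (schreier_graph A H)"
  then obtain g a where e: "e = (H #>\<^bsub>free_group A\<^esub> g, a)" "g \<in> carrier (free_group A)" "a \<in> letters A"
    by (auto simp: RCOSETS_def)
  show "tail (schreier_graph A H) e \<in> verts (schreier_graph A H)"
    using e by (auto simp: RCOSETS_def)
  have "freduce (g @ [a]) \<in> carrier (free_group A)"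
    using e by (simp add: freduce_snoc_in_carrier)
  then show "head (schreier_graph A H) e \<in> verts (schreier_graph A H)"
    using e assms by (auto simp: RCOSETS_def rcoset_word_step)
qed


section \<open>Prefixes avoided by a subgroup\<close>

lemma rcoset_eqD:
  assumes "subgroup H (free_group A)"
    and u: "u \<in> carrier (free_group A)" and v: "v \<in> carrier (free_group A)"
    and "H #>\<^bsub>free_group A\<^esub> u = H #>\<^bsub>free_group A\<^esub> v"
  shows "freduce (u @ rev (map linv v)) \<in> H"
proof -
  interpret group "free_group A" by (rule group_free_group)
  have "u \<otimes>\<^bsub>free_group A\<^esub> inv\<^bsub>free_group A\<^esub> v \<in> H"
    by (rule coset_join1[OF coset_mult_inv2[OF assms(4) u v subgroup.subset[OF assms(1)]] _ assms(1)])
      (simp add: u v)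
  then show ?thesis
    using v by (simp add: mult_free_group inv_free_group)
qed

lemma rcoset_append:
  assumes "subgroup H (free_group A)"
    and "H #>\<^bsub>free_group A\<^esub> u = H #>\<^bsub>free_group A\<^esub> v"
    and u: "u \<in> carrier (free_group A)" and v: "v \<in> carrier (free_group A)"
    and "set w \<subseteq> letters A"
  shows "H #>\<^bsub>free_group A\<^esub> freduce (u @ w) = H #>\<^bsub>free_group A\<^esub> freduce (v @ w)"
  using rcoset_step[OF subgroup.subset[OF assms(1)], of u w]
    rcoset_step[OF subgroup.subset[OF assms(1)], of v w] assms
  by (simp add: carrier_free_group freduce_reduced)

text \<open>
  If \<open>Hpv = Hp\<close>, then \<open>pvp\<inverse>\<close> or, for large \<open>k\<close>, the reduced form of \<open>pv\<^sup>kp\<inverse>\<close> is an element of \<open>H\<close>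
  with prefix \<open>p\<close>, depending on whether \<open>vp\<inverse>\<close> is reduced.
\<close>

lemma no_return:
  assumes H: "subgroup H (free_group A)"
    and p: "p \<in> carrier (free_group A)" and avoid: "\<And>u. p @ u \<notin> H"
    and pv: "p @ v \<in> carrier (free_group A)" and "v \<noteq> []"
  shows "H #>\<^bsub>free_group A\<^esub> (p @ v) \<noteq> H #>\<^bsub>free_group A\<^esub> p"
proof
  assume eq: "H #>\<^bsub>free_group A\<^esub> (p @ v) = H #>\<^bsub>free_group A\<^esub> p"
  show False
  proof (cases "p \<noteq> [] \<and> last v = last p")
    case False
    then have "reduced ((p @ v) @ rev (map linv p))"
      using p pv \<open>v \<noteq> []\<close>
      by (subst reduced_append) (auto simp: carrier_free_group reduced_inverse hd_rev last_map)
    then have "p @ v @ rev (map linv p) \<in> H"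
      using rcoset_eqD[OF H pv p eq] by (simp add: freduce_reduced)
    then show False
      using avoid by blast
  next
    case True
    \<comment> \<open>As \<open>p @ v\<close> is reduced, \<open>hd v\<close> differs from
      \<open>linv (last p)\<close>, which here equals \<open>linv (last v)\<close>.\<close>
    then have vv: "reduced (v @ v)"
      using pv \<open>v \<noteq> []\<close> by (auto simp: carrier_free_group reduced_append)
    have red: "reduced (v @ concat (replicate k v))" for k
    proof (induction k)
      case 0
      then show ?case using pv by (simp add: carrier_free_group reduced_append)
    next
      case (Suc k)
      then show ?case using reduced_overlap[OF vv _ \<open>v \<noteq> []\<close>] by simp
    qed
    define x where "x k = p @ concat (replicate k v)" for k
    have x: "x k \<in> carrier (free_group A)" for k
    proof (cases k)
      case 0
      then show ?thesis using p by (simp add: x_def)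
    next
      case (Suc j)
      have "set (x k) \<subseteq> letters A"
        using pv by (auto simp: x_def carrier_free_group)
      moreover have "reduced (x k)"
        unfolding x_def Suc using reduced_overlap[OF _ red[of j] \<open>v \<noteq> []\<close>] pv
        by (simp add: carrier_free_group)
      ultimately show ?thesis by (simp add: carrier_free_group)
    qed
    have coset: "H #>\<^bsub>free_group A\<^esub> x k = H #>\<^bsub>free_group A\<^esub> p" for k
    proof (induction k)
      case 0
      show ?case by (simp add: x_def)
    next
      case (Suc k)
      have "freduce ((p @ v) @ concat (replicate k v)) = x (Suc k)"
        using x[of "Suc k"] by (simp add: x_def carrier_free_group freduce_reduced)
      moreover have "freduce (p @ concat (replicate k v)) = x k"
        using x[of k] by (simp add: x_def carrier_free_group freduce_reduced)
      moreover have "set (concat (replicate k v)) \<subseteq> letters A"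
        using pv by (auto simp: carrier_free_group)
      ultimately show ?case
        using rcoset_append[OF H eq pv p, of "concat (replicate k v)"] Suc by simp
    qed
    \<comment> \<open>The exponent \<open>length p\<close> makes \<open>y\<close> at least twice as
      long as \<open>p\<close>. Multiplying the inverse of \<open>y\<close> on the left by
      \<open>p\<close> cancels at most \<open>length p\<close> letters, so the inverse of the
      product still begins with the first \<open>length p\<close> letters of \<open>y\<close>, that
      is, with \<open>p\<close>.\<close>
    define y where "y = x (length p)"
    have len: "length y \<ge> length p + length p"
      using \<open>v \<noteq> []\<close> by (cases v) (auto simp: y_def x_def length_concat sum_list_replicate)
    have inH: "freduce (p @ rev (map linv y)) \<in> H"
      using rcoset_eqD[OF H p x] coset by (simp add: y_def)
    moreover obtain z i where zi: "i \<le> length p" "freduce (p @ rev (map linv y)) = z @ drop i (rev (map linv y))"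
      using freduce_append_suffix[OF reduced_inverse, of y p thesis] x
      by (simp add: y_def carrier_free_group)
    ultimately have "rev (map linv (z @ drop i (rev (map linv y)))) \<in> H"
      using subgroup.m_inv_closed[OF H] subgroup.mem_carrier[OF H] inv_free_group by metis
    moreover have "rev (map linv (z @ drop i (rev (map linv y)))) =
        take (length y - i) y @ rev (map linv z)"
      by (simp add: drop_rev drop_map take_map rev_map comp_def)
    moreover have "take (length y - i) y = p @ take (length y - i - length p) (drop (length p) y)"
      using len zi by (simp add: y_def x_def)
    ultimately show False
      using avoid by (metis append_assoc)
  qed
qed

text \<open>
  After removing the longest common suffix of \<open>ps\<close> and \<open>pt\<close>, the word \<open>pst\<inverse>p\<inverse>\<close> is reduced unless
  one of \<open>s\<close>, \<open>t\<close> has become empty.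
\<close>

lemma rcoset_inj_cone:
  assumes H: "subgroup H (free_group A)"
    and p: "p \<in> carrier (free_group A)" and avoid: "\<And>u. p @ u \<notin> H"
    and "p @ s \<in> carrier (free_group A)" and "p @ t \<in> carrier (free_group A)"
    and "H #>\<^bsub>free_group A\<^esub> (p @ s) = H #>\<^bsub>free_group A\<^esub> (p @ t)"
  shows "s = t"
  using assms(4-)
proof (induction s arbitrary: t rule: rev_induct)
  case Nil
  then show ?case using no_return[OF H p avoid] by (metis append_Nil2)
next
  case (snoc a s)
  show ?case
  proof (cases t rule: rev_cases)
    case Nil
    then show ?thesis using no_return[OF H p avoid] snoc.prems by (metis append_Nil2)
  next
    case (snoc t' b)
    note t = this
    show ?thesis
    proof (cases "a = b")
      case True
      have car: "p @ s \<in> carrier (free_group A)" "p @ t' \<in> carrier (free_group A)"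
        using snoc.prems t by (auto simp: carrier_free_group reduced_append)
      have "freduce ((p @ s @ [a]) @ [linv a]) = p @ s" "freduce ((p @ t) @ [linv a]) = p @ t'"
        using snoc.prems True t freduce_snoc[of "p @ s @ [a]" "linv a"] freduce_snoc[of "p @ t" "linv a"]
        by (simp_all add: carrier_free_group butlast_append)
      then have "H #>\<^bsub>free_group A\<^esub> (p @ s) = H #>\<^bsub>free_group A\<^esub> (p @ t')"
        using rcoset_append[OF H snoc.prems(3,1,2), of "[linv a]"] snoc.prems(1)
        by (auto simp: carrier_free_group)
      then show ?thesis
        using snoc.IH car t True by blast
    next
      case False
      have "reduced ((p @ s @ [a]) @ rev (map linv (p @ t)))"
        using snoc.prems t False
        by (subst reduced_append) (simp_all add: carrier_free_group reduced_inverse[of "p @ t' @ [b]", simplified])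
      then have "p @ (s @ [a]) @ rev (map linv (p @ t)) \<in> H"
        using rcoset_eqD[OF H snoc.prems] by (simp add: freduce_reduced)
      then show ?thesis
        using avoid by blast
    qed
  qed
qed

section \<open>Hanging branches\<close>

lemma freduce_snoc_linv:
  "reduced w \<Longrightarrow> freduce (freduce (w @ [a]) @ [linv a]) = w"
  by (subst freduce_append_left) (use freduce_reduced[of w] in \<open>simp add: freduce_def\<close>)

text \<open>The branch consists of \<open>p\<close> and all reduced words that begin with a fixed
  one-letter prolongation \<open>q\<close> of \<open>p\<close>. By \<open>rcoset_inj_cone\<close>
  the coset map is injective on these vertices, hence also on the edges, which are pairs of a vertex
  and a label.\<close>

lemma hanging_branch_of_avoided_prefix:
  assumes H: "subgroup H (free_group A)"
    and p: "p \<in> carrier (free_group A)" "p \<noteq> []" and avoid: "\<And>u. p @ u \<notin> H"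
  shows "\<exists>B. hanging_branch A (schreier_graph A H) B"
proof -
  let ?F = "free_group A"
  \<comment> \<open>Repeating the last letter keeps the word reduced, since no letter is its own
    inverse.\<close>
  define q where "q = p @ [last p]"
  define C where "C = {w \<in> carrier ?F. \<exists>u. w = q @ u}"
  define V where "V = insert p C"
  define f where "f w = H #>\<^bsub>?F\<^esub> w" for w
  define g where "g = (\<lambda>(w, a :: 'a letter). (f w, a))"
  \<comment> \<open>The subgraph of the Cayley tree induced on \<open>V\<close>.\<close>
  define T where "T = \<lparr>verts = V, arcs = {e \<in> V \<times> letters A. freduce (fst e @ [snd e]) \<in> V},
    tail = fst, head = head (cayley_tree A)\<rparr>"
  define B where "B = \<lparr>verts = f ` V, arcs = g ` arcs T, tail = fst, head = head (schreier_graph A H)\<rparr>"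
  have sub: "H \<subseteq> carrier ?F"
    using H by (rule subgroup.subset)
  have V: "w \<in> carrier ?F" "\<exists>s. w = p @ s" if "w \<in> V" for w
    using that p by (auto simp: V_def C_def q_def)
  have lastp: "last p \<in> letters A"
    using p by (auto simp: carrier_free_group)
  have q: "q \<in> C"
    using p lastp by (auto simp: q_def C_def carrier_free_group reduced_append_single)
  have inj: "inj_on f V"
  proof (rule inj_onI)
    fix v w assume vw: "v \<in> V" "w \<in> V" "f v = f w"
    then obtain s t where "v = p @ s" "w = p @ t"
      using V(2) by meson
    then show "v = w"
      using rcoset_inj_cone[OF H p(1) avoid, of s t] vw V(1) by (simp add: f_def)
  qed
  \<comment> \<open>A step adds a letter or removes the last one, and the only word of
    \<open>C\<close> that loses the prefix \<open>q\<close> by a removal is \<open>q\<close> itself,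
    which becomes \<open>p\<close>. So every vertex of \<open>C\<close> has full degree.\<close>
  have C_step: "freduce (v @ [a]) \<in> V" if v: "v \<in> C" and a: "a \<in> letters A" for v a
  proof -
    obtain u where u: "v = q @ u" and vF: "v \<in> carrier ?F"
      using v by (auto simp: C_def)
    have car: "freduce (v @ [a]) \<in> carrier ?F"
      using vF a by (rule freduce_snoc_in_carrier)
    have "freduce (v @ [a]) = butlast v \<or> freduce (v @ [a]) = q @ (u @ [a])"
      using freduce_snoc[of v a] vF u by (simp add: carrier_free_group)
    moreover have "butlast v = (if u = [] then p else q @ butlast u)"
      using u by (simp add: q_def butlast_append)
    ultimately show ?thesis
      using car by (auto simp: V_def C_def split: if_splits)
  qed
  \<comment> \<open>A cancelling letter gives a word too short to have prefix \<open>p\<close>, and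
    any other letter than \<open>last p\<close> leads outside the cone over \<open>q\<close>. So the
    root has degree 1.\<close>
  have p_step: "freduce (p @ [a]) \<in> V \<longleftrightarrow> a = last p" for a
  proof
    assume a: "freduce (p @ [a]) \<in> V"
    then obtain s where s: "freduce (p @ [a]) = p @ s"
      using V by blast
    then have "length (butlast p) < length (freduce (p @ [a]))"
      using p(2) by (cases p) auto
    then have "freduce (p @ [a]) = p @ [a]"
      using freduce_snoc[of p a] p by (auto simp: carrier_free_group split: if_splits)
    then show "a = last p"
      using a by (auto simp: V_def C_def q_def)
  next
    assume "a = last p"
    then show "freduce (p @ [a]) \<in> V"
      using q by (auto simp: V_def C_def q_def carrier_free_group freduce_reduced)
  qed
  have pC: "p \<notin> C"
    by (auto simp: C_def q_def)
  have T_simps: "verts T = V" "tail T = fst" "head T = head (cayley_tree A)"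
    "(w, a) \<in> arcs T \<longleftrightarrow> w \<in> V \<and> a \<in> letters A \<and> freduce (w @ [a]) \<in> V" for w a
    by (auto simp: T_def)
  have B_simps: "verts B = f ` V" "tail B = fst" "head B = head (schreier_graph A H)"
    "arcs B = g ` arcs T"
    by (auto simp: B_def)
  have wfT: "wf_digraph T"
    by unfold_locales (auto simp: T_simps)
  have T_rev: "(freduce (w @ [a]), linv a) \<in> arcs T" if "(w, a) \<in> arcs T" for w a
    using that V by (auto simp: T_simps carrier_free_group freduce_snoc_linv)
  have f_step: "f w #>\<^bsub>?F\<^esub> [a] = f (freduce (w @ [a]))" if "w \<in> V" "a \<in> letters A" for w a
    using that V sub by (simp add: f_def rcoset_word_step)
  have T_sub: "lsubgraph T (cayley_tree A)"
    unfolding lsubgraph_def subgraph_def compatible_def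
    using V wfT wf_cayley_tree T_rev by (auto simp: T_simps edge_rev_def)
  have "connected T"
  proof -
    \<comment> \<open>Paths from \<open>p\<close> spell words letter by letter; symmetry reverses
      them, so \<open>T\<close> is strongly connected, and this passes to its symmetric
      closure.\<close>
    have sym: "symmetric T"
      unfolding symmetric_conv
    proof safe
      fix w a assume e: "(w, a) \<in> arcs T"
      then have "tail T (w, a) = head T (freduce (w @ [a]), linv a)"
        using V by (simp add: T_simps carrier_free_group freduce_snoc_linv)
      moreover have "head T (w, a) = tail T (freduce (w @ [a]), linv a)"
        by (simp add: T_simps)
      ultimately show "\<exists>e2\<in>arcs T. tail T (w, a) = head T e2 \<and> head T (w, a) = tail T e2"
        using T_rev[OF e] by blast
    qed
    have adj: "w \<rightarrow>\<^bsub>T\<^esub> freduce (w @ [a])" if "(w, a) \<in> arcs T" for w a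
      using wf_digraph.dominatesI[OF wfT _ that] by (simp add: arc_to_ends_def T_simps)
    have "p \<rightarrow>\<^sup>*\<^bsub>T\<^esub> (q @ u)" if "q @ u \<in> C" for u
      using that
    proof (induction u rule: rev_induct)
      case Nil
      have "(p, last p) \<in> arcs T"
        using p_step lastp by (simp add: T_simps V_def)
      moreover have "freduce (p @ [last p]) = q"
        using q by (auto simp: q_def C_def carrier_free_group freduce_reduced)
      ultimately show ?case
        using adj wf_digraph.reachable_adjI[OF wfT] by fastforce
    next
      case (snoc a u)
      then have qu: "q @ u \<in> C" "a \<in> letters A" "freduce ((q @ u) @ [a]) = q @ u @ [a]"
        by (auto simp: C_def carrier_free_group reduced_append freduce_reduced)
      then have "(q @ u, a) \<in> arcs T"
        using snoc.prems by (simp add: T_simps V_def)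
      then have "(q @ u) \<rightarrow>\<^bsub>T\<^esub> (q @ u @ [a])"
        using adj qu by metis
      then show ?case
        using snoc.IH[OF qu(1)] wf_digraph.reachable_adj_trans[OF wfT] by blast
    qed
    then have reach: "p \<rightarrow>\<^sup>*\<^bsub>T\<^esub> w" if "w \<in> V" for w
      using that wf_digraph.reachable_refl[OF wfT, of p] by (auto simp: V_def C_def T_simps)
    have "strongly_connected T"
    proof (rule strongly_connectedI)
      show "verts T \<noteq> {}"
        by (simp add: T_simps V_def)
    next
      fix u v assume "u \<in> verts T" "v \<in> verts T"
      then have "u \<rightarrow>\<^sup>*\<^bsub>T\<^esub> p" "p \<rightarrow>\<^sup>*\<^bsub>T\<^esub> v"
        using reach symmetric_reachable[OF sym, of p u] by (simp_all add: T_simps)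
      then show "u \<rightarrow>\<^sup>*\<^bsub>T\<^esub> v"
        by (rule wf_digraph.reachable_trans[OF wfT])
    qed
    then show ?thesis
      unfolding connected_def strongly_connected_def
      using wf_digraph.reachable_mk_symmetricI[OF wfT] by auto
  qed
  moreover have "out_degree T p = 1"
  proof -
    have "p \<in> V"
      by (simp add: V_def)
    then have "e \<in> out_arcs T p \<longleftrightarrow> e = (p, last p)" for e
      using p_step[of "snd e"] lastp by (cases e) (auto simp: out_arcs_def T_simps)
    then have "out_arcs T p = {(p, last p)}"
      by blast
    then show ?thesis
      by (simp add: out_degree_def)
  qed
  moreover have "out_degree T v = 2 * card A" if "v \<in> verts T - {p}" for v
  proof -
    have "v \<in> C"
      using that by (auto simp: T_simps V_def)
    then have "out_arcs T v = {v} \<times> letters A"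
      using C_step by (auto simp: out_arcs_def T_simps V_def)
    then show ?thesis
      by (simp add: out_degree_def card_cartesian_product letters_card)
  qed
  ultimately have "branch A T"
    using T_sub by (auto simp: branch_def T_simps V_def)
  moreover have "lgraph_iso T B"
    unfolding lgraph_iso_def
  proof (intro exI conjI ballI)
    show "bij_betw f (verts T) (verts B)"
      using inj by (simp add: T_simps B_simps inj_on_imp_bij_betw)
    have "inj_on g (arcs T)"
      using inj by (auto simp: inj_on_def g_def T_simps)
    then show "bij_betw g (arcs T) (arcs B)"
      by (simp add: B_simps inj_on_imp_bij_betw)
  next
    fix e assume "e \<in> arcs T"
    then show "tail B (g e) = f (tail T e)" "head B (g e) = f (head T e)" "snd (g e) = snd e"
      by (cases e; simp add: T_simps B_simps g_def f_step)+
  qed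
  moreover have "lsubgraph B (schreier_graph A H)"
  proof -
    have "wf_digraph B"
      by unfold_locales (auto simp: B_simps T_simps g_def f_step)
    moreover have "f ` V \<subseteq> rcosets\<^bsub>?F\<^esub> H"
      using V by (auto simp: f_def RCOSETS_def)
    moreover have "edge_rev (schreier_graph A H) e \<in> arcs B" if eB: "e \<in> arcs B" for e
    proof -
      obtain w a where e: "e = g (w, a)" "(w, a) \<in> arcs T"
        using eB by (auto simp: B_simps)
      then have "edge_rev (schreier_graph A H) e = g (freduce (w @ [a]), linv a)"
        by (simp add: g_def edge_rev_def T_simps f_step)
      then show ?thesis
        using T_rev e by (auto simp: B_simps)
    qed
    ultimately show ?thesis
      unfolding lsubgraph_def subgraph_def compatible_def
      using wf_schreier_graph[OF sub] by (auto simp: B_simps T_simps g_def)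
  qed
  ultimately show ?thesis
    unfolding hanging_branch_def by blast
qed

section \<open>From a hanging branch to an avoided word\<close>

text \<open>An isomorphism preserving labels maps the path spelling \<open>c # u\<close> from the
  root of the tree branch to the path with the same labels in the Schreier graph. The tree paths end
  at distinct vertices by cancellation in the free group, so the cosets are distinct. Here
  \<open>g\<close> represents the image of the root and \<open>c\<close> labels its edge.\<close>

lemma hanging_branch_cone:
  assumes "finite A" and H: "H \<subseteq> carrier (free_group A)"
    and "hanging_branch A (schreier_graph A H) B"
  obtains g c where "g \<in> carrier (free_group A)" "c \<in> letters A"
    "inj_on (\<lambda>u. H #>\<^bsub>free_group A\<^esub> freduce (g @ c # u)) {u. c # u \<in> carrier (free_group A)}"
proof -
  let ?F = "free_group A"
  interpret F: group ?F by (rule group_free_group)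
  obtain T where B: "lsubgraph B (schreier_graph A H)" and T: "branch A T" and "lgraph_iso T B"
    using assms(3) by (auto simp: hanging_branch_def)
  then obtain f h where f: "bij_betw f (verts T) (verts B)" and h: "bij_betw h (arcs T) (arcs B)"
    and fh: "\<And>e. e \<in> arcs T \<Longrightarrow> tail B (h e) = f (tail T e) \<and> head B (h e) = f (head T e) \<and> snd (h e) = snd e"
    unfolding lgraph_iso_def by metis
  have "tail B = tail (schreier_graph A H)" "head B = head (schreier_graph A H)"
    using B unfolding lsubgraph_def subgraph_def compatible_def by metis+
  then have B_simps: "tail B = fst" "head B (x, a) = x #>\<^bsub>?F\<^esub> [a]" for x a
    by simp_all
  have vB: "verts B \<subseteq> rcosets\<^bsub>?F\<^esub> H"
    using B by (auto simp: lsubgraph_def subgraph_def)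
  have "tail T = tail (cayley_tree A)" "head T = head (cayley_tree A)"
    using T unfolding branch_def lsubgraph_def subgraph_def compatible_def by metis+
  then have T_simps: "tail T = fst" "head T (w, a) = freduce (w @ [a])" for w a
    by simp_all
  have wfT: "wf_digraph T" and vT: "verts T \<subseteq> carrier ?F" and aT: "arcs T \<subseteq> carrier ?F \<times> letters A"
    using T by (auto simp: branch_def lsubgraph_def subgraph_def)
  obtain r where r: "r \<in> verts T" "out_degree T r = 1"
    and full: "\<And>v. v \<in> verts T \<Longrightarrow> v \<noteq> r \<Longrightarrow> out_degree T v = 2 * card A"
    using T by (auto simp: branch_def)
  have rF: "r \<in> carrier ?F"
    using r vT by blast
  obtain e where "out_arcs T r = {e}"
    using r(2) by (auto simp: out_degree_def card_1_singleton_iff)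
  then have "e \<in> out_arcs T r"
    by simp
  then obtain c where rc: "(r, c) \<in> arcs T"
    by (cases e) (auto simp: out_arcs_def T_simps)
  have c: "c \<in> letters A"
    using rc aT by blast
  \<comment> \<open>Out-edges at a vertex differ by their labels; as the alphabet is finite, full
    degree means that every letter occurs.\<close>
  have full_arcs: "(v, a) \<in> arcs T" if "v \<in> verts T" "v \<noteq> r" "a \<in> letters A" for v a
  proof -
    have "out_arcs T v \<subseteq> {v} \<times> letters A"
      using aT by (auto simp: out_arcs_def T_simps)
    moreover have "card (out_arcs T v) = card ({v} \<times> letters A)"
      using full[OF that(1,2)] by (simp add: out_degree_def card_cartesian_product letters_card)
    ultimately have "out_arcs T v = {v} \<times> letters A"
      using finite_letters[OF assms(1)] by (intro card_subset_eq) auto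
    then show ?thesis
      using that(3) by (auto simp: out_arcs_def)
  qed
  have "f r \<in> rcosets\<^bsub>?F\<^esub> H"
    using bij_betwE[OF f] r(1) vB by blast
  then obtain g where g: "g \<in> carrier ?F" "f r = H #>\<^bsub>?F\<^esub> g"
    by (auto simp: RCOSETS_def)
  have step: "freduce (w @ [a]) \<in> verts T \<and> f (freduce (w @ [a])) = f w #>\<^bsub>?F\<^esub> [a]"
    if "(w, a) \<in> arcs T" for w a
  proof -
    have "h (w, a) = (f w, a)"
      using fh[OF that] by (simp add: B_simps T_simps prod_eq_iff)
    then show ?thesis
      using fh[OF that] wf_digraph.head_in_verts[OF wfT that] by (simp add: B_simps T_simps)
  qed
  have cancel: "freduce (r @ u) = freduce (r @ v) \<longleftrightarrow> u = v"
    if "u \<in> carrier ?F" "v \<in> carrier ?F" for u v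
    using F.Units_l_cancel[of r u v] that rF by (simp add: mult_free_group)
  have cone: "freduce (r @ c # u) \<in> verts T \<and> f (freduce (r @ c # u)) = H #>\<^bsub>?F\<^esub> freduce (g @ c # u)"
    if "c # u \<in> carrier ?F" for u
    using that
  proof (induction u rule: rev_induct)
    case Nil
    then show ?case
      using step[OF rc] rcoset_word_step[OF H g(1) c] g(2) by simp
  next
    case (snoc a u)
    let ?v = "freduce (r @ c # u)"
    have cu: "c # u \<in> carrier ?F" and a: "a \<in> letters A"
      using snoc.prems by (auto simp: carrier_free_group reduced_append_single simp flip: append_Cons)
    \<comment> \<open>A nonempty reduced word moves \<open>r\<close>, so \<open>?v\<close> is an
      interior vertex, from which the path may continue with any letter.\<close>
    have "?v \<noteq> freduce (r @ [])"
      using cancel[OF cu F.one_closed] by (simp add: one_free_group)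
    then have "?v \<noteq> r"
      using rF by (simp add: carrier_free_group freduce_reduced)
    then have "(?v, a) \<in> arcs T"
      using snoc.IH[OF cu] a by (intro full_arcs) auto
    moreover have "freduce (?v @ [a]) = freduce (r @ c # u @ [a])"
      by (simp add: freduce_append_left)
    moreover have "(H #>\<^bsub>?F\<^esub> freduce (g @ c # u)) #>\<^bsub>?F\<^esub> [a] = H #>\<^bsub>?F\<^esub> freduce (g @ c # u @ [a])"
      using rcoset_step[OF H, of "g @ c # u" "[a]"] g(1) cu a
      by (simp add: carrier_free_group freduce_reduced reduced_Cons)
    ultimately show ?case
      using step[of ?v a] snoc.IH[OF cu] by simp
  qed
  have "inj_on (\<lambda>u. H #>\<^bsub>?F\<^esub> freduce (g @ c # u)) {u. c # u \<in> carrier ?F}"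
  proof (rule inj_onI, clarify)
    fix u v assume uv: "c # u \<in> carrier ?F" "c # v \<in> carrier ?F"
      and "H #>\<^bsub>?F\<^esub> freduce (g @ c # u) = H #>\<^bsub>?F\<^esub> freduce (g @ c # v)"
    then have "freduce (r @ c # u) = freduce (r @ c # v)"
      using cone[OF uv(1)] cone[OF uv(2)] f by (metis bij_betw_imp_inj_on inj_onD)
    then show "u = v"
      using cancel[OF uv] by simp
  qed
  then show thesis
    using that g(1) c by blast
qed

text \<open>An element \<open>p @ u\<close> of \<open>H\<close>, with \<open>p\<close> the reduced
  form of \<open>g\<close> times a high power of \<open>c\<close>, would place the coset
  \<open>H\<close> too deep in the branch.\<close>

lemma avoided_prefix_of_hanging_branch:
  assumes "finite A" and H: "subgroup H (free_group A)"
    and "hanging_branch A (schreier_graph A H) B"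
  obtains p where "p \<in> carrier (free_group A)" "p \<noteq> []" "\<And>u. p @ u \<notin> H"
proof -
  let ?F = "free_group A"
  obtain g c where g: "g \<in> carrier ?F" and c: "c \<in> letters A"
    and inj: "inj_on (\<lambda>u. H #>\<^bsub>?F\<^esub> freduce (g @ c # u)) {u. c # u \<in> carrier ?F}"
    using hanging_branch_cone[OF assms(1) subgroup.subset[OF H] assms(3)] .
  \<comment> \<open>By injectivity at most one \<open>u\<close> yields the coset \<open>H\<close>,
    so one bound suffices; if there is none, any \<open>n\<close> will do.\<close>
  obtain n where n: "\<And>u. c # u \<in> carrier ?F \<Longrightarrow> H #>\<^bsub>?F\<^esub> freduce (g @ c # u) = H \<Longrightarrow> length u < n"
  proof (cases "\<exists>u. c # u \<in> carrier ?F \<and> H #>\<^bsub>?F\<^esub> freduce (g @ c # u) = H")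
    case True
    then obtain u where u: "c # u \<in> carrier ?F" "H #>\<^bsub>?F\<^esub> freduce (g @ c # u) = H"
      by blast
    have "length v < Suc (length u)" if "c # v \<in> carrier ?F" "H #>\<^bsub>?F\<^esub> freduce (g @ c # v) = H" for v
      using inj_onD[OF inj, of u v] u that by auto
    then show ?thesis
      using that by blast
  next
    case False
    then show ?thesis
      using that by blast
  qed
  \<comment> \<open>At most \<open>length g\<close> copies of \<open>c\<close> cancel against
    \<open>g\<close>, so with one extra copy \<open>p\<close> still ends in \<open>c\<close>.
    Moreover \<open>k - 1\<close> is at least \<open>n\<close>, which contradicts the bound on the
    depth of \<open>H\<close>.\<close>
  define k where "k = n + Suc (length g)"
  define p where "p = freduce (g @ replicate k c)"
  obtain v i where vi: "i \<le> length g" "p = v @ drop i (replicate k c)"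
    unfolding p_def using freduce_append_suffix[OF reduced_replicate] by metis
  define j where "j = n + (length g - i)"
  have "k - i = Suc j"
    using vi by (simp add: j_def k_def)
  then have pj: "p = v @ replicate (Suc j) c"
    using vi \<open>k - i = Suc j\<close> by simp
  have pF: "p \<in> carrier ?F"
    unfolding p_def using g c by (intro freduce_in_carrier) (auto simp: carrier_free_group)
  have "p @ u \<notin> H" for u
  proof
    assume pu: "p @ u \<in> H"
    have puF: "p @ u \<in> carrier ?F"
      using subgroup.mem_carrier[OF H pu] .
    \<comment> \<open>The last letter \<open>c\<close> of \<open>p\<close> is split off:
      \<open>c # u\<close> is reduced as part of \<open>p @ u\<close>, and overlapping it in this
      \<open>c\<close> with a power of \<open>c\<close> keeps the word reduced.\<close>
    have "p @ u = (v @ replicate j c) @ ([c] @ u)"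
      by (simp add: pj replicate_app_Cons_same)
    then have "reduced ([c] @ u)"
      using puF by (metis carrier_free_group reduced_append)
    moreover have "reduced (replicate (k - 1) c @ [c])"
      using reduced_replicate[of "Suc (k - 1)" c] by (simp add: replicate_append_same)
    ultimately have "reduced (replicate (k - 1) c @ [c] @ u)"
      by (intro reduced_overlap) auto
    moreover have "replicate (k - 1) c @ [c] @ u = c # replicate (k - 1) c @ u"
      by (simp add: replicate_app_Cons_same)
    ultimately have "reduced (c # replicate (k - 1) c @ u)"
      by (simp only:)
    then have car: "c # replicate (k - 1) c @ u \<in> carrier ?F"
      using c puF by (auto simp: carrier_free_group)
    have "freduce (g @ c # replicate (k - 1) c @ u) = freduce (p @ u)"
      by (simp add: p_def freduce_append_left k_def)
    also have "\<dots> = p @ u"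
      using puF by (simp add: carrier_free_group freduce_reduced)
    finally have "H #>\<^bsub>?F\<^esub> freduce (g @ c # replicate (k - 1) c @ u) = H"
      using group.coset_join2[OF group_free_group puF H pu] by simp
    then have "length (replicate (k - 1) c @ u) < n"
      using n car by blast
    then show False
      by (simp add: k_def)
  qed
  then show thesis
    using that pF pj by simp
qed

section \<open>Boundary words, the core and the equivalence\<close>

text \<open>The last letter of \<open>p\<close> is repeated forever, which creates no
  cancellation.\<close>

lemma exists_boundary_extension:
  assumes "p \<in> carrier (free_group A)" "p \<noteq> []"
  obtains \<omega> where "\<omega> \<in> boundary A" "map \<omega> [0..<length p] = p"
proof
  define \<omega> where "\<omega> i = (if i < length p then p ! i else last p)" for i
  have "\<omega> i \<in> letters A" for i
    using assms last_in_set[OF assms(2)] nth_mem[of i p] by (auto simp: \<omega>_def carrier_free_group)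
  moreover have "\<omega> (Suc i) \<noteq> linv (\<omega> i)" for i
  proof (cases "Suc i < length p")
    case True
    then show ?thesis
      using assms by (simp add: \<omega>_def carrier_free_group reduced_def)
  next
    case False
    then have "i < length p \<Longrightarrow> i = length p - 1"
      by linarith
    then have "\<omega> i = last p"
      using assms(2) by (auto simp: \<omega>_def last_conv_nth)
    moreover have "\<omega> (Suc i) = last p"
      using False by (simp add: \<omega>_def)
    ultimately show ?thesis
      by simp
  qed
  ultimately show "\<omega> \<in> boundary A"
    by (simp add: boundary_def)
  show "map \<omega> [0..<length p] = p"
    by (intro nth_equalityI) (auto simp: \<omega>_def)
qed

lemma map_boundary_in_carrier:
  "\<omega> \<in> boundary A \<Longrightarrow> map \<omega> [0..<n] \<in> carrier (free_group A)"
  by (auto simp: boundary_def carrier_free_group reduced_def)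

text \<open>The root of a branch has degree 1, so a hanging branch contains an edge, and its removal
  already changes the arcs of \<open>X\<close>.\<close>

lemma core_eq_iff:
  "core A X = X \<longleftrightarrow> \<not> (\<exists>B. hanging_branch A X B)"
proof
  assume core: "core A X = X"
  show "\<not> (\<exists>B. hanging_branch A X B)"
  proof
    assume "\<exists>B. hanging_branch A X B"
    then obtain B T where B: "hanging_branch A X B" "branch A T" "lgraph_iso T B" "arcs B \<subseteq> arcs X"
      by (auto simp: hanging_branch_def lsubgraph_def subgraph_def)
    obtain r where "out_degree T r = 1"
      using B(2) by (auto simp: branch_def)
    then have "arcs T \<noteq> {}"
      by (auto simp: out_degree_def out_arcs_def)
    then have "arcs B \<noteq> {}"
      using B(3) by (auto simp: lgraph_iso_def bij_betw_def)
    then obtain e where "e \<in> arcs B"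
      by blast
    then have "e \<in> arcs X" "e \<notin> arcs (core A X)"
      using B(1,4) by (auto simp: core_def)
    then show False
      using core by simp
  qed
qed (simp add: core_def)

theorem corollary3p10:
  fixes A :: "'a set" and H :: "'a letter list set"
  assumes "finite A" and "card A \<ge> 2"
    and "subgroup H (free_group A)" and "H \<noteq> {\<one>\<^bsub>free_group A\<^esub>}"
  shows "(limit_set A H = boundary A \<longleftrightarrow> \<not> (\<exists>B. hanging_branch A (schreier_graph A H) B)) \<and>
    ((\<not> (\<exists>B. hanging_branch A (schreier_graph A H) B)) \<longleftrightarrow>
       core A (schreier_graph A H) = schreier_graph A H)"
proof -
  have limit: "\<omega> \<in> limit_set A H \<longleftrightarrow> \<omega> \<in> boundary A \<and> (\<forall>n. \<exists>u. map \<omega> [0..<n] @ u \<in> H)" for \<omega>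
    using assms(3) by (intro limit_set_iff subgroup.subset)
  have "limit_set A H = boundary A \<longleftrightarrow> \<not> (\<exists>B. hanging_branch A (schreier_graph A H) B)"
  proof
    assume eq: "limit_set A H = boundary A"
    show "\<not> (\<exists>B. hanging_branch A (schreier_graph A H) B)"
    proof
      assume "\<exists>B. hanging_branch A (schreier_graph A H) B"
      then obtain p where p: "p \<in> carrier (free_group A)" "p \<noteq> []" "\<And>u. p @ u \<notin> H"
        using avoided_prefix_of_hanging_branch[OF assms(1,3)] by metis
      obtain \<omega> where "\<omega> \<in> boundary A" "map \<omega> [0..<length p] = p"
        using exists_boundary_extension[OF p(1,2)] .
      then show False
        using limit[of \<omega>] eq p(3) by metis
    qed
  next
    assume none: "\<not> (\<exists>B. hanging_branch A (schreier_graph A H) B)"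
    have "\<exists>u. map \<omega> [0..<n] @ u \<in> H" if "\<omega> \<in> boundary A" for \<omega> n
    \<comment> \<open>The empty prefix is treated apart, because only a nonempty avoided word yields
      a branch; it is a prefix of the identity of \<open>H\<close>.\<close>
    proof (cases "n = 0")
      case True
      then show ?thesis
        using subgroup.one_closed[OF assms(3)] by auto
    next
      case False
      then show ?thesis
        using hanging_branch_of_avoided_prefix[OF assms(3) map_boundary_in_carrier[OF that, of n]] none
        by auto
    qed
    then show "limit_set A H = boundary A"
      using limit by blast
  qed
  then show ?thesis
    by (simp add: core_eq_iff)
qed

end
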